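(* PEDAL is sound for PEDAL-models: for every formula $A$ of $\mathcal{L}_1$, if $\vdash_{\mathrm{PEDAL}}A$ then $M,s\vDash A$ for every PEDAL-model $M$ and every state $s$ of $M$.
   Context: Ground language (PDL$^\Box$): $\mathsf{At}_\mathsf{f}$, $\mathsf{At}_\mathsf{p}$ are countably infinite sets of atomic formulas and atomic programs. Ground formulas and programs: $\gamma ::= a\in\mathsf{At}_\mathsf{f}\mid\bot\mid\neg\gamma\mid\gamma\lor\gamma\mid\langle\pi\rangle\gamma\mid\Box\gamma$ and $\pi::=\mathsf{p}\in\mathsf{At}_\mathsf{p}\mid\pi;\pi\mid\pi\cup\pi\mid\pi^*\mid ?\gamma$; $[\pi]\gamma:=\neg\langle\pi\rangle\neg\gamma$, $\Diamond\gamma:=\neg\Box\neg\gamma$. A PDL$^\Box$-model is $\langle S,v_\mathsf{f},v_\mathsf{p},R_\Box\rangle$ with $S\neq\emptyset$, $v_\mathsf{f}:\mathsf{At}_\mathsf{f}\to 2^S$, $R_\Box$ an equivalence relation on $S$, $v_\mathsf{p}:\mathsf{At}_\mathsf{p}\to 2^{S\times S}$ with $v_\mathsf{p}(\mathsf{p})\subseteq R_\Box$. Truth: $s\vDash a$ iff $s\in v_\mathsf{f}(a)$; $s\not\vDash\bot$; $\neg,\lor$ classical; $\llbracket\mathsf{p}\rrbracket=v_\mathsf{p}(\mathsf{p})$, $\llbracket\pi_1;\pi_2\rrbracket=\llbracket\pi_1\rrbracket\circ\llbracket\pi_2\rrbracket$ (first $\pi_1$ then $\pi_2$), $\llbracket\pi_1\cup\pi_2\rrbracket=\llbracket\pi_1\rrbracket\cup\llbracket\pi_2\rrbracket$,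 $\llbracket\pi^*\rrbracket=\bigcup_{i\ge0}\llbracket\pi\rrbracket^i$, $\llbracket ?\gamma\rrbracket=\{\langle s,s\rangle:s\vDash\gamma\}$; $s\vDash\langle\pi\rangle\gamma$ iff some $t$ with $\langle s,t\rangle\in\llbracket\pi\rrbracket$ has $t\vDash\gamma$; $s\vDash\Box\gamma$ iff $t\vDash\gamma$ for all $\langle s,t\rangle\in R_\Box$. The Hilbert system PDL$^\Box$ has axioms: propositional tautologies; $[\pi](\gamma_1\to\gamma_2)\to([\pi]\gamma_1\to[\pi]\gamma_2)$; $[\pi](\gamma_1\land\gamma_2)\leftrightarrow([\pi]\gamma_1\land[\pi]\gamma_2)$; $[\pi_1\cup\pi_2]\gamma\leftrightarrow([\pi_1]\gamma\land[\pi_2]\gamma)$; $[?\alpha]\beta\leftrightarrow(\alpha\to\beta)$; $[\pi_1;\pi_2]\gamma\leftrightarrow[\pi_1][\pi_2]\gamma$; $(\gamma\land[\pi][\pi^*]\gamma)\leftrightarrow[\pi^*]\gamma$; $(\gamma\land[\pi^*](\gamma\to[\pi]\gamma))\to[\pi^*]\gamma$; $\Box(\gamma_1\to\gamma_2)\to(\Box\gamma_1\to\Box\gamma_2)$; $\Box\gamma\to\gamma$; $\Diamond\gamma\to\Box\Diamond\gamma$; $\langle\pi\rangle\gamma\to\Diamond\gamma$; rules: modus ponens, from $\gamma$ infer $[\pi]\gamma$, from $\gamma$ infer $\Box\gamma$. Language $\mathcal{L}_1$: atoms $\Pr(\gamma)\ge q$ ($\gamma$ ground, $q\in[0,1]\cap\mathbb{Q}$),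 closed under $\neg,\lor$. Abbreviations: $\Pr(\gamma)<q:=\neg\Pr(\gamma)\ge q$; $\Pr(\gamma)\le q:=\Pr(\neg\gamma)\ge1-q$; $\Pr(\gamma)=q:=\Pr(\gamma)\ge q\land\Pr(\gamma)\le q$. PEDAL-model: $M=\langle S,v_\mathsf{f},R_\Box,\Pi,\mu\rangle$ with $S\ne\emptyset$, $v_\mathsf{f}:\mathsf{At}_\mathsf{f}\to2^S$, $R_\Box$ an equivalence relation on $S$; $\mathsf{Val}^S_\mathsf{p}$ the set of all $v:\mathsf{At}_\mathsf{p}\to2^{S\times S}$ with $v(\mathsf{p})\subseteq R_\Box$ for all $\mathsf{p}$; $\Pi$ a finite partition of $\mathsf{Val}^S_\mathsf{p}$; $\mu:\Pi\to[0,1]$ with $\sum_{P\in\Pi}\mu(P)=1$ and $\mu(P)\ne0$ only if $P$ finite. For $V\subseteq\mathsf{Val}^S_\mathsf{p}$, $\mu(V)=\sum_{P\in\Pi,\mu(P)\ne0}\mu(P)\frac{|P\cap V|}{|P|}$. $M(v):=\langle S,v_\mathsf{f},v,R_\Box\rangle$; $\mu(s,\gamma):=\mu(\{v: M(v),s\vDash\gamma\})$. $M,s\vDash\Pr(\gamma)\ge q$ iff $\mu(s,\gamma)\ge q$; $\neg,\lor$ classical. PEDAL ($\gamma,\gamma_i$ ground, $r,r_i\in[0,1]\cap\mathbb{Q}$): (A1) $\mathcal{L}_1$-instances of tautologies; (A2) $\Pr(\gamma)\ge0$; (A3) $\Pr(\gamma)=1\lor\Pr(\gamma)=0$ if $\gamma$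 contains no $\langle\pi\rangle$; (A4) $\Pr(\gamma)\le r_1\to\Pr(\gamma)<r_2$ when $r_1<r_2$; (A5) $\Pr(\gamma)<r\to\Pr(\gamma)\le r$; (A6) $(\Pr(\gamma_1)\ge r_1\land\Pr(\gamma_2)\ge r_2\land\Pr(\gamma_1\land\gamma_2)=0)\to\Pr(\gamma_1\lor\gamma_2)\ge\min(1,r_1+r_2)$; (A7) $(\Pr(\gamma_1)\le r_1\land\Pr(\gamma_2)<r_2)\to\Pr(\gamma_1\lor\gamma_2)<r_1+r_2$ when $r_1+r_2\le1$; (R1) modus ponens; (R2) from $\vdash_{\mathrm{PDL}^\Box}\gamma$ infer $\Pr(\gamma)=1$; (R3) for $r>0$, from $A\to\Pr(\gamma)\ge r-\frac1k$ for all integers $k\ge\frac1r$ infer $A\to\Pr(\gamma)\ge r$. Derivations are sequences of length a finite or countable successor ordinal, each member an axiom or following from earlier members by a rule. *)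

theory Defs
  imports
    Complex_Main
    "HOL-Library.Countable"
    "HOL-Library.Disjoint_Sets"
    "HOL-Library.Infinite_Typeclass"
begin

section \<open>The ground language and its semantics\<close>

datatype ('f, 'p) gform =
    GAtom 'f
  | GBot
  | GNeg "('f, 'p) gform"
  | GOr "('f, 'p) gform" "('f, 'p) gform"
  | GDia "('f, 'p) prog" "('f, 'p) gform"
  | GBox "('f, 'p) gform"
and ('f, 'p) prog =
    PAtom 'p
  | PSeq "('f, 'p) prog" "('f, 'p) prog"
  | PChoice "('f, 'p) prog" "('f, 'p) prog"
  | PStar "('f, 'p) prog"
  | PTest "('f, 'p) gform"

abbreviation GAnd :: "('f, 'p) gform \<Rightarrow> ('f, 'p) gform \<Rightarrow> ('f, 'p) gform" where
  "GAnd \<alpha> \<beta> \<equiv> GNeg (GOr (GNeg \<alpha>) (GNeg \<beta>))"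

abbreviation GImp :: "('f, 'p) gform \<Rightarrow> ('f, 'p) gform \<Rightarrow> ('f, 'p) gform" where
  "GImp \<alpha> \<beta> \<equiv> GOr (GNeg \<alpha>) \<beta>"

abbreviation GIff :: "('f, 'p) gform \<Rightarrow> ('f, 'p) gform \<Rightarrow> ('f, 'p) gform" where
  "GIff \<alpha> \<beta> \<equiv> GAnd (GImp \<alpha> \<beta>) (GImp \<beta> \<alpha>)"

abbreviation GAll :: "('f, 'p) prog \<Rightarrow> ('f, 'p) gform \<Rightarrow> ('f, 'p) gform" where
  "GAll \<pi> \<gamma> \<equiv> GNeg (GDia \<pi> (GNeg \<gamma>))"

abbreviation GPoss :: "('f, 'p) gform \<Rightarrow> ('f, 'p) gform" where
  "GPoss \<gamma> \<equiv> GNeg (GBox (GNeg \<gamma>))"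

record ('f, 'p, 's) pdl_model =
  states :: "'s set"
  valf :: "'f \<Rightarrow> 's set"
  valp :: "'p \<Rightarrow> ('s \<times> 's) set"
  box_rel :: "('s \<times> 's) set"

definition is_pdl_model :: "('f, 'p, 's) pdl_model \<Rightarrow> bool" where
  "is_pdl_model M \<longleftrightarrow>
     states M \<noteq> {} \<and>
     (\<forall>a. valf M a \<subseteq> states M) \<and>
     equiv (states M) (box_rel M) \<and>
     (\<forall>p. valp M p \<subseteq> box_rel M)"

text \<open>
  The zeroth power of a relation is the identity on the whole type of states, so the
  iteration is restricted to the states of the model.
\<close>

primrec gsat :: "('f, 'p, 's) pdl_model \<Rightarrow> 's \<Rightarrow> ('f, 'p) gform \<Rightarrow> bool"
  and psem :: "('f, 'p, 's) pdl_model \<Rightarrow> ('f, 'p) prog \<Rightarrow> ('s \<times> 's) set" where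
  "gsat M s (GAtom a) \<longleftrightarrow> s \<in> valf M a"
| "gsat M s GBot \<longleftrightarrow> False"
| "gsat M s (GNeg \<gamma>) \<longleftrightarrow> \<not> gsat M s \<gamma>"
| "gsat M s (GOr \<alpha> \<beta>) \<longleftrightarrow> gsat M s \<alpha> \<or> gsat M s \<beta>"
| "gsat M s (GDia \<pi> \<gamma>) \<longleftrightarrow> (\<exists>t. (s, t) \<in> psem M \<pi> \<and> gsat M t \<gamma>)"
| "gsat M s (GBox \<gamma>) \<longleftrightarrow> (\<forall>t. (s, t) \<in> box_rel M \<longrightarrow> gsat M t \<gamma>)"
| "psem M (PAtom p) = valp M p"
| "psem M (PSeq \<pi> \<rho>) = psem M \<pi> O psem M \<rho>"
| "psem M (PChoice \<pi> \<rho>) = psem M \<pi> \<union> psem M \<rho>"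
| "psem M (PStar \<pi>) = (\<Union>i::nat. psem M \<pi> ^^ i) \<inter> states M \<times> states M"
| "psem M (PTest \<gamma>) = {(s, s) | s. s \<in> states M \<and> gsat M s \<gamma>}"

section \<open>Propositional tautologies\<close>

datatype pform = PVar nat | PBot | PNeg pform | POr pform pform

primrec peval :: "(nat \<Rightarrow> bool) \<Rightarrow> pform \<Rightarrow> bool" where
  "peval e (PVar n) \<longleftrightarrow> e n"
| "peval e PBot \<longleftrightarrow> False"
| "peval e (PNeg \<phi>) \<longleftrightarrow> \<not> peval e \<phi>"
| "peval e (POr \<phi> \<psi>) \<longleftrightarrow> peval e \<phi> \<or> peval e \<psi>"

definition tautology :: "pform \<Rightarrow> bool" where
  "tautology \<phi> \<longleftrightarrow> (\<forall>e. peval e \<phi>)"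

primrec ginst :: "(nat \<Rightarrow> ('f, 'p) gform) \<Rightarrow> pform \<Rightarrow> ('f, 'p) gform" where
  "ginst \<sigma> (PVar n) = \<sigma> n"
| "ginst \<sigma> PBot = GBot"
| "ginst \<sigma> (PNeg \<phi>) = GNeg (ginst \<sigma> \<phi>)"
| "ginst \<sigma> (POr \<phi> \<psi>) = GOr (ginst \<sigma> \<phi>) (ginst \<sigma> \<psi>)"

section \<open>The Hilbert system for the ground language\<close>

inductive pdl_provable :: "('f, 'p) gform \<Rightarrow> bool" where
  pdl_taut: "tautology \<phi> \<Longrightarrow> pdl_provable (ginst \<sigma> \<phi>)"
| pdl_K: "pdl_provable (GImp (GAll \<pi> (GImp \<gamma>\<^sub>1 \<gamma>\<^sub>2)) (GImp (GAll \<pi> \<gamma>\<^sub>1) (GAll \<pi> \<gamma>\<^sub>2)))"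
| pdl_conj: "pdl_provable (GIff (GAll \<pi> (GAnd \<gamma>\<^sub>1 \<gamma>\<^sub>2)) (GAnd (GAll \<pi> \<gamma>\<^sub>1) (GAll \<pi> \<gamma>\<^sub>2)))"
| pdl_choice: "pdl_provable (GIff (GAll (PChoice \<pi>\<^sub>1 \<pi>\<^sub>2) \<gamma>) (GAnd (GAll \<pi>\<^sub>1 \<gamma>) (GAll \<pi>\<^sub>2 \<gamma>)))"
| pdl_test: "pdl_provable (GIff (GAll (PTest \<alpha>) \<beta>) (GImp \<alpha> \<beta>))"
| pdl_seq: "pdl_provable (GIff (GAll (PSeq \<pi>\<^sub>1 \<pi>\<^sub>2) \<gamma>) (GAll \<pi>\<^sub>1 (GAll \<pi>\<^sub>2 \<gamma>)))"
| pdl_star: "pdl_provable (GIff (GAnd \<gamma> (GAll \<pi> (GAll (PStar \<pi>) \<gamma>))) (GAll (PStar \<pi>) \<gamma>))"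
| pdl_ind: "pdl_provable
    (GImp (GAnd \<gamma> (GAll (PStar \<pi>) (GImp \<gamma> (GAll \<pi> \<gamma>)))) (GAll (PStar \<pi>) \<gamma>))"
| pdl_box_K: "pdl_provable (GImp (GBox (GImp \<gamma>\<^sub>1 \<gamma>\<^sub>2)) (GImp (GBox \<gamma>\<^sub>1) (GBox \<gamma>\<^sub>2)))"
| pdl_box_T: "pdl_provable (GImp (GBox \<gamma>) \<gamma>)"
| pdl_box_5: "pdl_provable (GImp (GPoss \<gamma>) (GBox (GPoss \<gamma>)))"
| pdl_dia_poss: "pdl_provable (GImp (GDia \<pi> \<gamma>) (GPoss \<gamma>))"
| pdl_mp: "pdl_provable \<alpha> \<Longrightarrow> pdl_provable (GImp \<alpha> \<beta>) \<Longrightarrow> pdl_provable \<beta>"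
| pdl_nec: "pdl_provable \<gamma> \<Longrightarrow> pdl_provable (GAll \<pi> \<gamma>)"
| pdl_box_nec: "pdl_provable \<gamma> \<Longrightarrow> pdl_provable (GBox \<gamma>)"

section \<open>The probabilistic language\<close>

typedef unit_rat = "{q :: rat. 0 \<le> q \<and> q \<le> 1}"
  morphisms rat_of unit_rat
  by (rule exI[of _ 0]) simp

datatype ('f, 'p) lform =
    PrGe "('f, 'p) gform" unit_rat
  | LNeg "('f, 'p) lform"
  | LOr "('f, 'p) lform" "('f, 'p) lform"

abbreviation LAnd :: "('f, 'p) lform \<Rightarrow> ('f, 'p) lform \<Rightarrow> ('f, 'p) lform" where
  "LAnd A B \<equiv> LNeg (LOr (LNeg A) (LNeg B))"

abbreviation LImp :: "('f, 'p) lform \<Rightarrow> ('f, 'p) lform \<Rightarrow> ('f, 'p) lform" where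
  "LImp A B \<equiv> LOr (LNeg A) B"

abbreviation PrLt :: "('f, 'p) gform \<Rightarrow> unit_rat \<Rightarrow> ('f, 'p) lform" where
  "PrLt \<gamma> q \<equiv> LNeg (PrGe \<gamma> q)"

abbreviation PrLe :: "('f, 'p) gform \<Rightarrow> unit_rat \<Rightarrow> ('f, 'p) lform" where
  "PrLe \<gamma> q \<equiv> PrGe (GNeg \<gamma>) (unit_rat (1 - rat_of q))"

abbreviation PrEq :: "('f, 'p) gform \<Rightarrow> unit_rat \<Rightarrow> ('f, 'p) lform" where
  "PrEq \<gamma> q \<equiv> LAnd (PrGe \<gamma> q) (PrLe \<gamma> q)"

section \<open>Models of the probabilistic language\<close>

record ('f, 'p, 's) pedal_model =
  mstates :: "'s set"
  mvalf :: "'f \<Rightarrow> 's set"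
  mbox_rel :: "('s \<times> 's) set"
  mpart :: "('p \<Rightarrow> ('s \<times> 's) set) set set"
  mweight :: "('p \<Rightarrow> ('s \<times> 's) set) set \<Rightarrow> real"

definition prog_vals :: "('s \<times> 's) set \<Rightarrow> ('p \<Rightarrow> ('s \<times> 's) set) set" where
  "prog_vals R = {v. \<forall>p. v p \<subseteq> R}"

definition is_pedal_model :: "('f, 'p, 's) pedal_model \<Rightarrow> bool" where
  "is_pedal_model M \<longleftrightarrow>
     mstates M \<noteq> {} \<and>
     (\<forall>a. mvalf M a \<subseteq> mstates M) \<and>
     equiv (mstates M) (mbox_rel M) \<and>
     finite (mpart M) \<and>
     partition_on (prog_vals (mbox_rel M)) (mpart M) \<and>
     (\<forall>P\<in>mpart M. 0 \<le> mweight M P \<and> mweight M P \<le> 1) \<and>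
     (\<Sum>P\<in>mpart M. mweight M P) = 1 \<and>
     (\<forall>P\<in>mpart M. mweight M P \<noteq> 0 \<longrightarrow> finite P)"

definition mprob :: "('f, 'p, 's) pedal_model \<Rightarrow> ('p \<Rightarrow> ('s \<times> 's) set) set \<Rightarrow> real" where
  "mprob M V =
     (\<Sum>P | P \<in> mpart M \<and> mweight M P \<noteq> 0.
        mweight M P * (real (card (P \<inter> V)) / real (card P)))"

definition model_at ::
  "('f, 'p, 's) pedal_model \<Rightarrow> ('p \<Rightarrow> ('s \<times> 's) set) \<Rightarrow> ('f, 'p, 's) pdl_model" where
  "model_at M v =
     \<lparr>states = mstates M, valf = mvalf M, valp = v, box_rel = mbox_rel M\<rparr>"

definition gprob :: "('f, 'p, 's) pedal_model \<Rightarrow> 's \<Rightarrow> ('f, 'p) gform \<Rightarrow> real" where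
  "gprob M s \<gamma> = mprob M {v \<in> prog_vals (mbox_rel M). gsat (model_at M v) s \<gamma>}"

primrec lsat :: "('f, 'p, 's) pedal_model \<Rightarrow> 's \<Rightarrow> ('f, 'p) lform \<Rightarrow> bool" where
  "lsat M s (PrGe \<gamma> q) \<longleftrightarrow> gprob M s \<gamma> \<ge> real_of_rat (rat_of q)"
| "lsat M s (LNeg A) \<longleftrightarrow> \<not> lsat M s A"
| "lsat M s (LOr A B) \<longleftrightarrow> lsat M s A \<or> lsat M s B"

section \<open>The infinitary proof system\<close>

text \<open>
  The probabilistic language has no falsum, so a propositional formula containing falsum
  has no instance in it.
\<close>

inductive linst :: "(nat \<Rightarrow> ('f, 'p) lform) \<Rightarrow> pform \<Rightarrow> ('f, 'p) lform \<Rightarrow> bool"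
  for \<sigma> :: "nat \<Rightarrow> ('f, 'p) lform" where
  "linst \<sigma> (PVar n) (\<sigma> n)"
| "linst \<sigma> \<phi> A \<Longrightarrow> linst \<sigma> (PNeg \<phi>) (LNeg A)"
| "linst \<sigma> \<phi> A \<Longrightarrow> linst \<sigma> \<psi> B \<Longrightarrow> linst \<sigma> (POr \<phi> \<psi>) (LOr A B)"

primrec dia_free :: "('f, 'p) gform \<Rightarrow> bool" where
  "dia_free (GAtom a) \<longleftrightarrow> True"
| "dia_free GBot \<longleftrightarrow> True"
| "dia_free (GNeg \<gamma>) \<longleftrightarrow> dia_free \<gamma>"
| "dia_free (GOr \<alpha> \<beta>) \<longleftrightarrow> dia_free \<alpha> \<and> dia_free \<beta>"
| "dia_free (GDia \<pi> \<gamma>) \<longleftrightarrow> False"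
| "dia_free (GBox \<gamma>) \<longleftrightarrow> dia_free \<gamma>"

text \<open>
  The side conditions below keep every argument of \<open>unit_rat\<close> in the unit interval,
  outside of which \<open>unit_rat\<close> is unspecified.
\<close>

inductive pedal_axiom :: "('f, 'p) lform \<Rightarrow> bool" where
  A1: "tautology \<phi> \<Longrightarrow> linst \<sigma> \<phi> A \<Longrightarrow> pedal_axiom A"
| A2: "pedal_axiom (PrGe \<gamma> (unit_rat 0))"
| A3: "dia_free \<gamma> \<Longrightarrow> pedal_axiom (LOr (PrEq \<gamma> (unit_rat 1)) (PrEq \<gamma> (unit_rat 0)))"
| A4: "rat_of r\<^sub>1 < rat_of r\<^sub>2 \<Longrightarrow> pedal_axiom (LImp (PrLe \<gamma> r\<^sub>1) (PrLt \<gamma> r\<^sub>2))"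
| A5: "pedal_axiom (LImp (PrLt \<gamma> r) (PrLe \<gamma> r))"
| A6: "pedal_axiom
    (LImp (LAnd (LAnd (PrGe \<gamma>\<^sub>1 r\<^sub>1) (PrGe \<gamma>\<^sub>2 r\<^sub>2)) (PrEq (GAnd \<gamma>\<^sub>1 \<gamma>\<^sub>2) (unit_rat 0)))
          (PrGe (GOr \<gamma>\<^sub>1 \<gamma>\<^sub>2) (unit_rat (min 1 (rat_of r\<^sub>1 + rat_of r\<^sub>2)))))"
| A7: "rat_of r\<^sub>1 + rat_of r\<^sub>2 \<le> 1 \<Longrightarrow> pedal_axiom
    (LImp (LAnd (PrLe \<gamma>\<^sub>1 r\<^sub>1) (PrLt \<gamma>\<^sub>2 r\<^sub>2))
          (PrLt (GOr \<gamma>\<^sub>1 \<gamma>\<^sub>2) (unit_rat (rat_of r\<^sub>1 + rat_of r\<^sub>2))))"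

text \<open>\<open>pedal_rule \<Gamma> A\<close>: the formula \<open>A\<close> follows from members of \<open>\<Gamma>\<close> by one rule.\<close>

inductive pedal_rule :: "('f, 'p) lform set \<Rightarrow> ('f, 'p) lform \<Rightarrow> bool"
  for \<Gamma> :: "('f, 'p) lform set" where
  R1: "A \<in> \<Gamma> \<Longrightarrow> LImp A B \<in> \<Gamma> \<Longrightarrow> pedal_rule \<Gamma> B"
| R2: "pdl_provable \<gamma> \<Longrightarrow> pedal_rule \<Gamma> (PrEq \<gamma> (unit_rat 1))"
| R3: "0 < rat_of r \<Longrightarrow>
    (\<And>k :: int. of_int k \<ge> 1 / rat_of r \<Longrightarrow>
       LImp A (PrGe \<gamma> (unit_rat (rat_of r - 1 / of_int k))) \<in> \<Gamma>) \<Longrightarrow>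
    pedal_rule \<Gamma> (LImp A (PrGe \<gamma> r))"

text \<open>
  A sequence of finite or countable successor length is a family indexed by a well-order
  with a last element.  Every countable ordinal is the order type of a well-order whose
  field consists of natural numbers, and \<open>underS r i\<close> is the set of indices before \<open>i\<close>.
  The indices are natural numbers, but their order \<open>r\<close> is arbitrary.
\<close>

definition pedal_derivation ::
  "nat rel \<Rightarrow> (nat \<Rightarrow> ('f, 'p) lform) \<Rightarrow> nat \<Rightarrow> bool" where
  "pedal_derivation r D m \<longleftrightarrow>
     Well_order r \<and> m \<in> Field r \<and> (\<forall>i\<in>Field r. (i, m) \<in> r) \<and>
     (\<forall>i\<in>Field r. pedal_axiom (D i) \<or> pedal_rule (D ` underS r i) (D i))"

definition pedal_provable :: "('f, 'p) lform \<Rightarrow> bool" where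
  "pedal_provable A \<longleftrightarrow> (\<exists>r D m. pedal_derivation r D m \<and> D m = A)"

end

theory Submission
  imports Defs
begin

text \<open>
  Transfinite derivations are handled by well-founded induction on the index order.  All
  probabilistic axioms come from two facts about the probability of a ground formula at a
  state: it obeys inclusion-exclusion, and it equals 1 on formulas true under every
  valuation of the atomic programs.  The infinitary rule holds because the real numbers are
  Archimedean.
\<close>

section \<open>Soundness of the ground system\<close>

text \<open>Atomic programs lie in the box relation by assumption; reflexivity covers tests and the
  empty iteration, transitivity covers composition and longer iterations.\<close>

lemma psem_subset_box_rel:
  assumes "is_pdl_model M"
  shows "psem M \<pi> \<subseteq> box_rel M"
proof -
  have eq: "equiv (states M) (box_rel M)" and vp: "\<And>p. valp M p \<subseteq> box_rel M"
    using assms by (auto simp: is_pdl_model_def)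
  have refl: "(s, s) \<in> box_rel M" if "s \<in> states M" for s
    using eq that by (auto simp: equiv_def refl_on_def)
  have trans: "trans (box_rel M)"
    using eq by (auto simp: equiv_def)
  show ?thesis
  \<comment> \<open>Formulas and programs are mutually recursive. Formulas get the trivial
    predicate, since a test relates states only to themselves.\<close>
  proof (induction \<pi> rule: prog.induct[where ?P1.0 = "\<lambda>_. True"])
    case (PAtom p)
    then show ?case using vp by simp
  next
    case (PSeq \<pi> \<rho>)
    then show ?case using trans by (auto dest: transD)
  next
    case (PStar \<pi>)
    have "(s, t) \<in> box_rel M" if "(s, t) \<in> (psem M \<pi>)\<^sup>*" "s \<in> states M" for s t
      using that
    proof (induction rule: rtrancl_induct)
      case base
      then show ?case using refl by simp
    next
      case (step t u)
      then show ?case using PStar trans by (meson subsetD transD)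
    qed
    then show ?case by (auto simp: rtrancl_is_UN_relpow)
  qed (use refl in auto)
qed

lemma box_rel_subset_states:
  assumes "is_pdl_model M"
  shows "box_rel M \<subseteq> states M \<times> states M"
  using assms by (auto simp: is_pdl_model_def equiv_def)

lemma psem_in_states:
  assumes "is_pdl_model M" "(s, t) \<in> psem M \<pi>"
  shows "s \<in> states M" "t \<in> states M"
  using psem_subset_box_rel[OF assms(1)] box_rel_subset_states[OF assms(1)] assms(2) by blast+

text \<open>Every program step ends in a state, so of the restriction to \<open>states M\<close>
  only the condition on the starting point remains. That condition excludes the reflexive pairs
  outside the model.\<close>

lemma psem_PStar_iff:
  assumes "is_pdl_model M"
  shows "(s, t) \<in> psem M (PStar \<pi>) \<longleftrightarrow> s \<in> states M \<and> (s, t) \<in> (psem M \<pi>)\<^sup>*"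
proof -
  have "t \<in> states M" if "(s, t) \<in> (psem M \<pi>)\<^sup>*" "s \<in> states M"
    using that by (induction rule: rtrancl_induct) (auto dest: psem_in_states[OF assms])
  then show ?thesis by (auto simp: rtrancl_is_UN_relpow)
qed

lemma gsat_GAll: "gsat M s (GAll \<pi> \<gamma>) \<longleftrightarrow> (\<forall>t. (s, t) \<in> psem M \<pi> \<longrightarrow> gsat M t \<gamma>)"
  by simp

text \<open>The form in which both star axioms are checked, as it gives access to the induction and
  case rules for \<open>rtrancl\<close>.\<close>

lemma gsat_GAll_PStar:
  assumes "is_pdl_model M" "s \<in> states M"
  shows "gsat M s (GAll (PStar \<pi>) \<gamma>) \<longleftrightarrow> (\<forall>t. (s, t) \<in> (psem M \<pi>)\<^sup>* \<longrightarrow> gsat M t \<gamma>)"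
  unfolding gsat_GAll psem_PStar_iff[OF assms(1)] using assms(2) by blast

lemma gsat_GAnd: "gsat M s (GAnd \<alpha> \<beta>) \<longleftrightarrow> gsat M s \<alpha> \<and> gsat M s \<beta>"
  by simp

lemma gsat_GImp: "gsat M s (GImp \<alpha> \<beta>) \<longleftrightarrow> (gsat M s \<alpha> \<longrightarrow> gsat M s \<beta>)"
  by simp

lemma gsat_GIff: "gsat M s (GIff \<alpha> \<beta>) \<longleftrightarrow> (gsat M s \<alpha> \<longleftrightarrow> gsat M s \<beta>)"
  by auto

lemma gsat_ginst: "gsat M s (ginst \<sigma> \<phi>) \<longleftrightarrow> peval (\<lambda>n. gsat M s (\<sigma> n)) \<phi>"
  by (induction \<phi>) auto

text \<open>The state is generalized in the induction because the two necessitation rules use their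
  premise at successor states.\<close>

theorem pdl_sound:
  assumes "pdl_provable \<gamma>" "is_pdl_model M" "s \<in> states M"
  shows "gsat M s \<gamma>"
  using assms(1,3)
proof (induction arbitrary: s)
  case (pdl_taut \<phi> \<sigma>)
  then show ?case by (simp add: gsat_ginst tautology_def)
next
  case (pdl_star \<gamma> \<pi>)
  let ?R = "psem M \<pi>"
  have "gsat M s (GAll \<pi> (GAll (PStar \<pi>) \<gamma>)) \<longleftrightarrow>
      (\<forall>u. (s, u) \<in> ?R \<longrightarrow> (\<forall>t. (u, t) \<in> ?R\<^sup>* \<longrightarrow> gsat M t \<gamma>))"
    unfolding gsat_GAll[of M s \<pi>]
    by (intro all_cong1 imp_cong refl gsat_GAll_PStar[OF assms(2)])
      (rule psem_in_states(2)[OF assms(2)])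
  \<comment> \<open>A path of the closure is either empty or a first step followed by a
    path.\<close>
  moreover have "(gsat M s \<gamma> \<and> (\<forall>u. (s, u) \<in> ?R \<longrightarrow> (\<forall>t. (u, t) \<in> ?R\<^sup>* \<longrightarrow> gsat M t \<gamma>)))
      \<longleftrightarrow> (\<forall>t. (s, t) \<in> ?R\<^sup>* \<longrightarrow> gsat M t \<gamma>)"
    by (blast elim: converse_rtranclE intro: converse_rtrancl_into_rtrancl)
  ultimately show ?case
    \<comment> \<open>\<open>GIff\<close> abbreviates a \<open>GAnd\<close>, so it has to be
      resolved before \<open>gsat_GAnd\<close> can break it up.\<close>
    unfolding gsat_GIff unfolding gsat_GAnd gsat_GAll_PStar[OF assms(2) pdl_star] by blast
next
  case (pdl_ind \<gamma> \<pi>)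
  let ?R = "psem M \<pi>"
  \<comment> \<open>Truth of \<gamma> is carried along the path one step at a time.\<close>
  have "gsat M t \<gamma>"
    if "gsat M s \<gamma>" and "\<forall>t. (s, t) \<in> ?R\<^sup>* \<longrightarrow> gsat M t (GImp \<gamma> (GAll \<pi> \<gamma>))"
      and "(s, t) \<in> ?R\<^sup>*" for t
    using that(3,1)
  proof (induction rule: rtrancl_induct)
    case (step t u)
    then show ?case using that(2) unfolding gsat_GImp gsat_GAll by blast
  qed
  then show ?case
    unfolding gsat_GImp[of M s] gsat_GAnd gsat_GAll_PStar[OF assms(2) pdl_ind] by blast
next
  case (pdl_box_T \<gamma>)
  then have "(s, s) \<in> box_rel M"
    using assms(2) by (auto simp: is_pdl_model_def equiv_def refl_on_def)
  then show ?case by auto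
next
  case (pdl_box_5 \<gamma>)
  have "sym (box_rel M)" "trans (box_rel M)"
    using assms(2) by (auto simp: is_pdl_model_def equiv_def)
  \<comment> \<open>An equivalence relation is Euclidean, which is what the axiom expresses.\<close>
  then have "(u, t) \<in> box_rel M" if "(s, t) \<in> box_rel M" "(s, u) \<in> box_rel M" for t u
    using that by (meson symD transD)
  then show ?case by auto
next
  case (pdl_dia_poss \<pi> \<gamma>)
  then show ?case using psem_subset_box_rel[OF assms(2)] by auto
next
  case (pdl_nec \<gamma> \<pi>)
  then show ?case using psem_in_states(2)[OF assms(2)] by auto
next
  case (pdl_box_nec \<gamma>)
  then show ?case using box_rel_subset_states[OF assms(2)] by auto
qed auto

section \<open>The probability of a ground formula\<close>

lemma mprob_nonneg:
  assumes "is_pedal_model M"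
  shows "0 \<le> mprob M V"
  using assms unfolding mprob_def is_pedal_model_def by (intro sum_nonneg) auto

lemma mprob_empty: "mprob M {} = 0"
  by (simp add: mprob_def)

text \<open>Inclusion-exclusion for cardinalities in each cell, weighted and summed. Only cells of
  nonzero weight are summed, and these are finite, so \<open>card\<close> is a true count.\<close>

lemma mprob_Un_Int:
  assumes "is_pedal_model M"
  shows "mprob M (V \<union> W) + mprob M (V \<inter> W) = mprob M V + mprob M W"
proof -
  have "real (card (P \<inter> (V \<union> W))) + real (card (P \<inter> (V \<inter> W)))
      = real (card (P \<inter> V)) + real (card (P \<inter> W))"
    if "finite P" for P
  proof -
    have "P \<inter> (V \<union> W) = (P \<inter> V) \<union> (P \<inter> W)" "P \<inter> (V \<inter> W) = (P \<inter> V) \<inter> (P \<inter> W)"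
      by blast+
    then show ?thesis
      using card_Un_Int[of "P \<inter> V" "P \<inter> W"] that by simp
  qed
  then have *: "mweight M P * (real (card (P \<inter> (V \<union> W))) / real (card P))
        + mweight M P * (real (card (P \<inter> (V \<inter> W))) / real (card P))
      = mweight M P * (real (card (P \<inter> V)) / real (card P))
        + mweight M P * (real (card (P \<inter> W)) / real (card P))"
    if "finite P" for P
    using that by (simp only: distrib_left[symmetric] add_divide_distrib[symmetric])
  show ?thesis
    unfolding mprob_def sum.distrib[symmetric]
    using assms by (intro sum.cong refl *) (auto simp: is_pedal_model_def)
qed

text \<open>Each summed cell is finite, nonempty and made of admissible valuations, so its quotient
  is 1; the cells left out have weight 0.\<close>

lemma mprob_prog_vals:
  assumes "is_pedal_model M"
  shows "mprob M (prog_vals (mbox_rel M)) = 1"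
proof -
  let ?V = "prog_vals (mbox_rel M)"
  have part: "partition_on ?V (mpart M)" and fin: "finite (mpart M)"
    using assms by (auto simp: is_pedal_model_def)
  have "mweight M P * (real (card (P \<inter> ?V)) / real (card P)) = mweight M P"
    if "P \<in> mpart M" "mweight M P \<noteq> 0" for P
  proof -
    have "P \<inter> ?V = P" "P \<noteq> {}"
      using part that by (auto simp: partition_on_def)
    moreover have "finite P"
      using assms that by (auto simp: is_pedal_model_def)
    ultimately show ?thesis by simp
  qed
  then have "mprob M ?V = (\<Sum>P | P \<in> mpart M \<and> mweight M P \<noteq> 0. mweight M P)"
    unfolding mprob_def by (intro sum.cong) auto
  also have "\<dots> = (\<Sum>P\<in>mpart M. mweight M P)"
    using fin by (intro sum.mono_neutral_left) auto
  also have "\<dots> = 1"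
    using assms by (simp add: is_pedal_model_def)
  finally show ?thesis .
qed

lemma gprob_nonneg: "is_pedal_model M \<Longrightarrow> 0 \<le> gprob M s \<gamma>"
  by (simp add: gprob_def mprob_nonneg)

lemma gprob_eq_1:
  assumes "is_pedal_model M"
    and "\<And>v. v \<in> prog_vals (mbox_rel M) \<Longrightarrow> gsat (model_at M v) s \<gamma>"
  shows "gprob M s \<gamma> = 1"
proof -
  have "{v \<in> prog_vals (mbox_rel M). gsat (model_at M v) s \<gamma>} = prog_vals (mbox_rel M)"
    using assms(2) by blast
  then show ?thesis by (simp add: gprob_def mprob_prog_vals[OF assms(1)])
qed

lemma gprob_eq_0:
  assumes "\<And>v. v \<in> prog_vals (mbox_rel M) \<Longrightarrow> \<not> gsat (model_at M v) s \<gamma>"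
  shows "gprob M s \<gamma> = 0"
proof -
  have "{v \<in> prog_vals (mbox_rel M). gsat (model_at M v) s \<gamma>} = {}"
    using assms by blast
  then show ?thesis by (simp only: gprob_def mprob_empty)
qed

lemma gprob_GOr_GAnd:
  assumes "is_pedal_model M"
  shows "gprob M s (GOr \<alpha> \<beta>) + gprob M s (GAnd \<alpha> \<beta>) = gprob M s \<alpha> + gprob M s \<beta>"
proof -
  let ?E = "\<lambda>\<gamma>. {v \<in> prog_vals (mbox_rel M). gsat (model_at M v) s \<gamma>}"
  have "?E (GOr \<alpha> \<beta>) = ?E \<alpha> \<union> ?E \<beta>" "?E (GAnd \<alpha> \<beta>) = ?E \<alpha> \<inter> ?E \<beta>"
    by auto
  then show ?thesis
    unfolding gprob_def by (simp only: mprob_Un_Int[OF assms])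
qed

text \<open>Inclusion-exclusion applied to excluded middle and contradiction, which have probability
  1 and 0.\<close>

lemma gprob_GNeg:
  assumes "is_pedal_model M"
  shows "gprob M s (GNeg \<gamma>) = 1 - gprob M s \<gamma>"
proof -
  have "gprob M s (GOr \<gamma> (GNeg \<gamma>)) = 1"
    by (rule gprob_eq_1[OF assms]) simp
  moreover have "gprob M s (GAnd \<gamma> (GNeg \<gamma>)) = 0"
    by (rule gprob_eq_0) simp
  ultimately show ?thesis
    using gprob_GOr_GAnd[OF assms, of s \<gamma> "GNeg \<gamma>"] by simp
qed

text \<open>The two models differ only in \<open>valp\<close>, which is consulted only inside a
  \<open>GDia\<close>.\<close>

lemma gsat_dia_free:
  assumes "dia_free \<gamma>"
  shows "gsat (model_at M v) s \<gamma> \<longleftrightarrow> gsat (model_at M w) s \<gamma>"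
  using assms
  by (induction \<gamma> arbitrary: s rule: gform.induct[where ?P2.0 = "\<lambda>_. True"])
    (auto simp: model_at_def)

lemma gprob_dia_free:
  assumes "is_pedal_model M" "dia_free \<gamma>"
  shows "gprob M s \<gamma> = 1 \<or> gprob M s \<gamma> = 0"
\<comment> \<open>The empty valuation serves as a sample: its verdict is that of all
  valuations.\<close>
proof (cases "gsat (model_at M (\<lambda>_. {})) s \<gamma>")
  case True
  have "gprob M s \<gamma> = 1"
    using gsat_dia_free[OF assms(2)] True by (intro gprob_eq_1[OF assms(1)]) (rule iffD1)
  then show ?thesis ..
next
  case False
  have "gprob M s \<gamma> = 0"
    by (rule gprob_eq_0) (use False gsat_dia_free[OF assms(2), of M _ s "\<lambda>_. {}"] in simp)
  then show ?thesis ..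
qed

text \<open>Every admissible valuation turns the model into a PDL model, where
  \<open>pdl_sound\<close> applies.\<close>

lemma gprob_pdl_provable:
  fixes M :: "('f, 'p, 's) pedal_model"
  assumes "is_pedal_model M" "s \<in> mstates M" "pdl_provable \<gamma>"
  shows "gprob M s \<gamma> = 1"
proof (rule gprob_eq_1[OF assms(1)])
  fix v :: "'p \<Rightarrow> ('s \<times> 's) set"
  assume "v \<in> prog_vals (mbox_rel M)"
  then have "is_pdl_model (model_at M v)"
    using assms(1) by (auto simp: is_pdl_model_def is_pedal_model_def model_at_def prog_vals_def)
  then show "gsat (model_at M v) s \<gamma>"
    using assms(2,3) by (intro pdl_sound) (auto simp: model_at_def)
qed

section \<open>Soundness of the infinitary system\<close>

lemma rat_of_unit_rat: "0 \<le> q \<Longrightarrow> q \<le> 1 \<Longrightarrow> rat_of (unit_rat q) = q"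
  by (simp add: unit_rat_inverse)

lemma rat_of_bounds: "0 \<le> rat_of r" "rat_of r \<le> 1"
  using rat_of[of r] by auto

text \<open>The complement \<open>1 - rat_of r\<close> stays in the unit interval, so
  \<open>unit_rat\<close> represents it faithfully.\<close>

lemma lsat_PrLe:
  assumes "is_pedal_model M"
  shows "lsat M s (PrLe \<gamma> r) \<longleftrightarrow> gprob M s \<gamma> \<le> real_of_rat (rat_of r)"
  by (auto simp: rat_of_unit_rat rat_of_bounds gprob_GNeg[OF assms] of_rat_diff)

lemma lsat_PrEq:
  assumes "is_pedal_model M"
  shows "lsat M s (PrEq \<gamma> r) \<longleftrightarrow> gprob M s \<gamma> = real_of_rat (rat_of r)"
  using lsat_PrLe[OF assms, of s \<gamma> r] by auto

lemma lsat_LImp: "lsat M s (LImp A B) \<longleftrightarrow> (lsat M s A \<longrightarrow> lsat M s B)"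
  by simp

lemma lsat_LAnd: "lsat M s (LAnd A B) \<longleftrightarrow> lsat M s A \<and> lsat M s B"
  by simp

lemma lsat_linst: "linst \<sigma> \<phi> A \<Longrightarrow> lsat M s A \<longleftrightarrow> peval (\<lambda>n. lsat M s (\<sigma> n)) \<phi>"
  by (induction rule: linst.induct) auto

lemma pedal_axiom_sound:
  assumes "pedal_axiom A" and M: "is_pedal_model M"
  shows "lsat M s A"
  using assms(1)
proof cases
  case (A1 \<phi> \<sigma>)
  then show ?thesis by (simp add: lsat_linst tautology_def)
next
  case (A2 \<gamma>)
  then show ?thesis by (simp add: rat_of_unit_rat gprob_nonneg[OF M])
next
  case (A3 \<gamma>)
  then show ?thesis
    unfolding A3 lsat.simps(3) lsat_PrEq[OF M]
    using gprob_dia_free[OF M, of \<gamma> s] by (simp add: rat_of_unit_rat)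
next
  case (A4 r\<^sub>1 r\<^sub>2 \<gamma>)
  have "real_of_rat (rat_of r\<^sub>1) < real_of_rat (rat_of r\<^sub>2)"
    using A4 by (simp add: of_rat_less)
  then show ?thesis
    unfolding A4 lsat_LImp lsat_PrLe[OF M] by simp
next
  case (A5 \<gamma> r)
  then show ?thesis
    unfolding A5 lsat_LImp lsat_PrLe[OF M] by simp
next
  case (A6 \<gamma>\<^sub>1 r\<^sub>1 \<gamma>\<^sub>2 r\<^sub>2)
  \<comment> \<open>Capping at 1 only weakens the bound; the sum itself is reached because the
    conjunction has probability 0.\<close>
  have "real_of_rat (min 1 (rat_of r\<^sub>1 + rat_of r\<^sub>2))
      \<le> real_of_rat (rat_of r\<^sub>1) + real_of_rat (rat_of r\<^sub>2)"
    by (metis min.cobounded2 of_rat_add of_rat_less_eq)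
  then show ?thesis
    unfolding A6 lsat_LImp lsat_LAnd
    using gprob_GOr_GAnd[OF M, of s \<gamma>\<^sub>1 \<gamma>\<^sub>2]
    by (simp add: gprob_GNeg[OF M, of s "GAnd \<gamma>\<^sub>1 \<gamma>\<^sub>2"] rat_of_unit_rat rat_of_bounds)
next
  case (A7 r\<^sub>1 r\<^sub>2 \<gamma>\<^sub>1 \<gamma>\<^sub>2)
  then show ?thesis
    unfolding A7 lsat_LImp lsat_LAnd lsat_PrLe[OF M]
    \<comment> \<open>Dropping the nonnegative conjunction term leaves subadditivity.\<close>
    using gprob_GOr_GAnd[OF M, of s \<gamma>\<^sub>1 \<gamma>\<^sub>2] gprob_nonneg[OF M, of s "GAnd \<gamma>\<^sub>1 \<gamma>\<^sub>2"]
    by (simp add: rat_of_unit_rat rat_of_bounds of_rat_add)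
qed

lemma ge_if_ge_minus_inverse:
  fixes g r :: real
  assumes "0 \<le> g" "0 < r"
    and approx: "\<And>k :: int. 1 / r \<le> of_int k \<Longrightarrow> r - 1 / of_int k \<le> g"
  shows "r \<le> g"
proof (rule ccontr)
  assume "\<not> r \<le> g"
  then have pos: "0 < r - g" by simp
  obtain k :: int where k: "1 / (r - g) < of_int k"
    using ex_less_of_int by blast
  \<comment> \<open>Since g is nonnegative, \<open>r - g\<close> is at most r, so the chosen k is in
    the range that \<open>approx\<close> covers.\<close>
  have "1 / r \<le> 1 / (r - g)"
    using assms(1,2) pos by (intro divide_left_mono) auto
  then have "r - 1 / of_int k \<le> g"
    using k by (intro approx) simp
  moreover have "0 < real_of_int k"
    using k pos by (meson less_trans zero_less_divide_1_iff)
  ultimately show False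
    using k pos by (simp add: field_simps)
qed

lemma pedal_rule_sound:
  assumes "pedal_rule \<Gamma> A" and M: "is_pedal_model M" and "s \<in> mstates M"
    and \<Gamma>: "\<And>B. B \<in> \<Gamma> \<Longrightarrow> lsat M s B"
  shows "lsat M s A"
  using assms(1)
proof cases
  case (R1 B)
  show ?thesis using \<Gamma>[OF R1(1)] \<Gamma>[OF R1(2)] by simp
next
  case (R2 \<gamma>)
  then show ?thesis
    unfolding R2 lsat_PrEq[OF M]
    using gprob_pdl_provable[OF M assms(3)] by (simp add: rat_of_unit_rat)
next
  case (R3 r B \<gamma>)
  let ?r = "real_of_rat (rat_of r)"
  have "?r \<le> gprob M s \<gamma>" if "lsat M s B"
  proof (rule ge_if_ge_minus_inverse)
    show "0 \<le> gprob M s \<gamma>" by (rule gprob_nonneg[OF M])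
    show "0 < ?r" using R3 by simp
    fix k :: int
    assume "1 / ?r \<le> of_int k"
    \<comment> \<open>The premises of the rule are indexed by a rational bound on k, so the real
      bound is transferred.\<close>
    then have "real_of_rat (1 / rat_of r) \<le> real_of_rat (of_int k)"
      by (simp add: of_rat_divide)
    then have k: "1 / rat_of r \<le> of_int k"
      by (simp only: of_rat_less_eq)
    have kpos: "0 < (of_int k :: rat)"
      using k R3(2) by (meson less_le_trans zero_less_divide_1_iff)
    \<comment> \<open>This is the lower half of showing that the threshold lies in the unit
      interval, where \<open>unit_rat\<close> is specified.\<close>
    then have "1 / of_int k \<le> rat_of r"
      using k R3(2) by (simp add: field_simps)
    moreover have "rat_of r - 1 / of_int k \<le> 1"
      using kpos rat_of_bounds(2)[of r] by (simp add: add_increasing2 diff_le_eq)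
    ultimately have "rat_of (unit_rat (rat_of r - 1 / of_int k)) = rat_of r - 1 / of_int k"
      by (intro rat_of_unit_rat) auto
    moreover have "lsat M s (PrGe \<gamma> (unit_rat (rat_of r - 1 / of_int k)))"
      using \<Gamma>[OF R3(3)[OF k]] that by simp
    ultimately show "?r - 1 / of_int k \<le> gprob M s \<gamma>"
      by (simp add: of_rat_diff of_rat_divide)
  qed
  then show ?thesis using R3 by simp
qed

theorem theorem2:
  fixes A :: "('f::{countable, infinite}, 'p::{countable, infinite}) lform"
    and M :: "('f, 'p, 's) pedal_model"
    and s :: 's
  assumes "pedal_provable A"
    and "is_pedal_model M"
    and "s \<in> mstates M"
  shows "lsat M s A"
proof -
  obtain r D m where "pedal_derivation r D m" and A: "D m = A"
    using assms(1) by (auto simp: pedal_provable_def)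
  then have wf: "wf (r - Id)" and m: "m \<in> Field r"
    and step: "\<And>i. i \<in> Field r \<Longrightarrow> pedal_axiom (D i) \<or> pedal_rule (D ` underS r i) (D i)"
    by (auto simp: pedal_derivation_def well_order_on_def)
  \<comment> \<open>The induction runs over all naturals, so membership in the index set is part of
    the claim. Indices in \<open>underS r i\<close> are predecessors under \<open>r - Id\<close> and
    again lie in the field.\<close>
  have "i \<in> Field r \<longrightarrow> lsat M s (D i)" for i
    using wf
  proof (induction i rule: wf_induct_rule)
    case (less i)
    have "lsat M s B" if "B \<in> D ` underS r i" for B
      using that less by (auto simp: underS_def Field_def)
    then show ?case
      using step pedal_axiom_sound[OF _ assms(2)] pedal_rule_sound[OF _ assms(2,3)] by blast
  qed
  then show ?thesis using m A by blast
qed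

end
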